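(* Let $G$ be a finite simple graph with no isolated vertices such that the adjacency matrix of $G$ has at most two eigenvalues (counted with multiplicity) different from $-2$ and $0$. If the adjacency matrix of $G$ has exactly one positive eigenvalue, then $G$ is one of the following: (1) $G_0(\ell,m)=K_{\ell,m}$ with $\ell\geq m\geq 1$, with spectrum $\{0^{\ell+m-2},\ \pm\sqrt{\ell m}\}$; (2) $G_1=K_{1,1,3}$, with spectrum $\{-2,\ -1,\ 0^2,\ 3\}$; (3) $G_2(k,m)=K_{2,\ldots,2,m}$, the complete $k$-partite graph with $k\geq 3$ classes, $k-1$ of size $2$ and one of size $m\geq 1$, with spectrum $\{-2^{k-2},\ 0^{k+m-2},\ k-2\pm\sqrt{k^2+2(k-1)(m-2)}\}$.
   Context: In spectra, exponents denote multiplicities. $K_{n_1,\ldots,n_k}$ denotes the complete multipartite graph with classes of sizes $n_1,\ldots,n_k$. *)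

theory Defs
  imports
    "Graph_Theory.Graph_Theory"
    "Jordan_Normal_Form.Char_Poly"
begin

text \<open>
  Finite simple graphs are the \<open>pair_graph\<close>s of the library: finite, symmetric, loop-free
  arc relations on a vertex set, so each undirected edge is a pair of opposite arcs.
\<close>

definition adjacency_mat :: "'a pair_pre_digraph \<Rightarrow> 'a list \<Rightarrow> real mat" where
  "adjacency_mat G vs = mat (length vs) (length vs)
     (\<lambda>(i, j). if (vs ! i, vs ! j) \<in> parcs G then 1 else 0)"

text \<open>
  The eigenvalues of the adjacency matrix as a multiset, i.e. the roots of its characteristic
  polynomial with multiplicity. The matrix is real symmetric, so no eigenvalue is lost by taking
  real roots only, and algebraic and geometric multiplicities agree. The lemma
  \<open>adj_spectrum_eq\<close> below shows that the chosen enumeration of the vertices is irrelevant.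
\<close>

definition adj_spectrum :: "'a pair_pre_digraph \<Rightarrow> real multiset" where
  "adj_spectrum G =
     proots (char_poly (adjacency_mat G (SOME vs. distinct vs \<and> set vs = pverts G)))"

text \<open>Vertex \<open>(i, j)\<close> is the \<open>j\<close>-th vertex of the \<open>i\<close>-th class.\<close>

definition complete_multipartite :: "nat list \<Rightarrow> (nat \<times> nat) pair_pre_digraph" where
  "complete_multipartite ns =
     (let V = {(i, j). i < length ns \<and> j < ns ! i}
      in \<lparr> pverts = V, parcs = {(u, v). u \<in> V \<and> v \<in> V \<and> fst u \<noteq> fst v} \<rparr>)"

lemma similar_adjacency_mat:
  assumes "distinct vs" "distinct ws" "set vs = set ws"
  shows "similar_mat (adjacency_mat G vs) (adjacency_mat G ws)"
proof -
  define n where "n = length vs"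
  have n': "length ws = n"
    using assms unfolding n_def by (metis distinct_card)
  define P where
    "P = (\<lambda>us xs :: 'a list. mat n n (\<lambda>(i, j). if us ! i = xs ! j then 1 else 0 :: real))"
  have collapse: "(\<Sum>k = 0..<n. (if us ! i = xs ! k then 1 else 0) * f (xs ! k)) = f (us ! i)"
    if "distinct xs" "length xs = n" "us ! i \<in> set xs" for us xs i and f :: "'a \<Rightarrow> real"
  proof -
    have "\<exists>k < n. xs ! k = us ! i"
      using that(2,3) by (auto simp: in_set_conv_nth)
    then obtain k where k: "k < n" "xs ! k = us ! i" by blast
    have "(\<Sum>k' = 0..<n. (if us ! i = xs ! k' then 1 else 0) * f (xs ! k'))
        = (\<Sum>k' = 0..<n. if k' = k then f (us ! i) else 0)"
      using k that by (intro sum.cong) (auto simp: nth_eq_iff_index_eq)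
    then show ?thesis using k by simp
  qed
  have inv: "P us xs * P xs us = 1\<^sub>m n"
    if "distinct us" "distinct xs" "length us = n" "length xs = n" "set us = set xs" for us xs
  proof (rule eq_matI)
    fix i j assume "i < dim_row (1\<^sub>m n :: real mat)" "j < dim_col (1\<^sub>m n :: real mat)"
    then have ij: "i < n" "j < n" by auto
    have "(P us xs * P xs us) $$ (i, j)
        = (\<Sum>k = 0..<n. (if us ! i = xs ! k then 1 else 0) * (if xs ! k = us ! j then 1 else 0))"
      using ij by (simp add: P_def scalar_prod_def)
    also have "\<dots> = (if us ! i = us ! j then 1 else 0)"
    proof -
      have "us ! i \<in> set xs"
        using that ij nth_mem by blast
      then show ?thesis
        using collapse[of xs us i "\<lambda>x. if x = us ! j then 1 else 0"] that by blast
    qed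
    finally show "(P us xs * P xs us) $$ (i, j) = 1\<^sub>m n $$ (i, j)"
      using ij that by (simp add: nth_eq_iff_index_eq)
  qed (auto simp: P_def)
  have conj: "adjacency_mat G vs = P vs ws * adjacency_mat G ws * P ws vs"
  proof (rule eq_matI)
    fix i j
    assume "i < dim_row (P vs ws * adjacency_mat G ws * P ws vs)"
      and "j < dim_col (P vs ws * adjacency_mat G ws * P ws vs)"
    then have ij: "i < n" "j < n" by (auto simp: P_def)
    have mem: "vs ! i \<in> set ws" "vs ! j \<in> set ws"
      using ij assms n_def nth_mem by blast+
    have left: "(P vs ws * adjacency_mat G ws) $$ (i, k)
        = (if (vs ! i, ws ! k) \<in> parcs G then 1 else 0)"
      if "k < n" for k
    proof -
      have "(P vs ws * adjacency_mat G ws) $$ (i, k) = (\<Sum>l = 0..<n.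
          (if vs ! i = ws ! l then 1 else 0) * (if (ws ! l, ws ! k) \<in> parcs G then 1 else 0))"
        using ij that n' by (simp add: P_def adjacency_mat_def scalar_prod_def)
      then show ?thesis
        using collapse[of ws vs i "\<lambda>x. if (x, ws ! k) \<in> parcs G then 1 else 0"] assms n' mem
        by simp
    qed
    have "(P vs ws * adjacency_mat G ws * P ws vs) $$ (i, j)
        = (\<Sum>k = 0..<n. (P vs ws * adjacency_mat G ws) $$ (i, k) * P ws vs $$ (k, j))"
      using ij n' by (simp add: P_def adjacency_mat_def scalar_prod_def)
    also have "\<dots> = (\<Sum>k = 0..<n. (if vs ! j = ws ! k then 1 else 0)
        * (if (vs ! i, ws ! k) \<in> parcs G then 1 else 0))"
      using ij left by (intro sum.cong) (auto simp: P_def)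
    also have "\<dots> = adjacency_mat G vs $$ (i, j)"
      using collapse[of ws vs j "\<lambda>x. if (vs ! i, x) \<in> parcs G then 1 else 0"] assms n' mem ij
      by (simp add: adjacency_mat_def n_def)
    finally show "adjacency_mat G vs $$ (i, j) = (P vs ws * adjacency_mat G ws * P ws vs) $$ (i, j)" ..
  qed (auto simp: P_def adjacency_mat_def n_def)
  show ?thesis
  proof (rule similar_matI[OF _ _ _ conj])
    show "{adjacency_mat G vs, adjacency_mat G ws, P vs ws, P ws vs} \<subseteq> carrier_mat n n"
      using n' by (auto simp: P_def adjacency_mat_def n_def)
  qed (use inv assms n' n_def in auto)
qed

lemma adj_spectrum_eq:
  assumes "distinct vs" "set vs = pverts G"
  shows "adj_spectrum G = proots (char_poly (adjacency_mat G vs))"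
proof -
  let ?ws = "SOME vs. distinct vs \<and> set vs = pverts G"
  have "distinct ?ws \<and> set ?ws = pverts G"
    using assms by (intro someI[of "\<lambda>vs. distinct vs \<and> set vs = pverts G" vs]) auto
  then have "similar_mat (adjacency_mat G ?ws) (adjacency_mat G vs)"
    using assms by (intro similar_adjacency_mat) auto
  then show ?thesis
    unfolding adj_spectrum_def by (simp add: char_poly_similar)
qed

end

theory Submission
  imports Defs
begin

text \<open>
  If some vertex \<open>u\<close> is adjacent to neither end of an edge \<open>vw\<close>, then for any neighbour \<open>x\<close> of
  \<open>u\<close> the quadratic form of the adjacency matrix is positive definite on the plane spanned by the
  indicator vectors \<open>v + w\<close> and \<open>2u + x\<close>. By the spectral theorem this contradicts the
  existence of only one positive eigenvalue, so non-adjacency is an equivalence relation and \<open>G\<close>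
  is complete multipartite. With class sizes \<open>n\<^sub>1, \<dots>, n\<^sub>k\<close> its characteristic
  polynomial is \<open>x\<^sup>n\<^sup>-\<^sup>k\<close> times \<open>q(x) = P(x) (1 - \<Sum> n\<^sub>i / (x + n\<^sub>i))\<close>, where
  \<open>P(x)\<close> is the product of the \<open>x + n\<^sub>i\<close>. Since \<open>q(0) \<noteq> 0\<close>, the root \<open>-2\<close> of
  \<open>q\<close> has multiplicity at least \<open>k - 2\<close>. If \<open>t > 0\<close> classes have size 2, its multiplicity is
  \<open>t - 1\<close>, hence \<open>t \<ge> k - 1\<close>. If no class has size 2, the root is simple by monotonicity
  of the second factor, hence \<open>k \<le> 3\<close>, and for \<open>k = 3\<close> the equation \<open>q(-2) = 0\<close> forces the
  sizes 1, 1, 3.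
\<close>

section \<open>The polynomial of a list of class sizes\<close>

definition class_prod :: "nat list \<Rightarrow> real poly" where
  "class_prod ns = (\<Prod>n\<leftarrow>ns. [:real n, 1:])"

text \<open>
  The recursion unfolds to the product of all \<open>x + n\<close> minus the sum over all \<open>i\<close> of
  \<open>n\<^sub>i\<close> times the product of the \<open>x + n\<^sub>j\<close> with \<open>j \<noteq> i\<close>.
  Up to powers of \<open>x\<close> this is the characteristic polynomial of a complete multipartite graph.
\<close>

fun mp_poly :: "nat list \<Rightarrow> real poly" where
  "mp_poly [] = 1"
| "mp_poly (n # ns) = [:real n, 1:] * mp_poly ns - Polynomial.smult (real n) (class_prod ns)"

lemma class_prod_simps [simp]:
  "class_prod [] = 1"
  "class_prod (n # ns) = [:real n, 1:] * class_prod ns"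
  by (simp_all add: class_prod_def)

lemma poly_class_prod_eq_0_iff: "poly (class_prod ns) x = 0 \<longleftrightarrow> - x \<in> real ` set ns"
  by (induction ns) (auto simp del: mult_pCons_left)

text \<open>Positivity of \<open>x\<close> keeps all denominators nonzero. This range is enough,
  since \<open>poly_eqI_pos\<close> compares polynomials on the positive reals only.\<close>

lemma poly_mp_poly:
  assumes "x > 0"
  shows "poly (mp_poly ns) x = poly (class_prod ns) x * (1 - (\<Sum>n\<leftarrow>ns. real n / (x + real n)))"
proof (induction ns)
  case (Cons n ns)
  have n: "(x + real n) * (real n / (x + real n)) = real n"
    using assms by simp
  let ?S = "\<Sum>n\<leftarrow>ns. real n / (x + real n)"
  have "poly (mp_poly (n # ns)) x = (x + real n) * (poly (class_prod ns) x * (1 - ?S))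
      - (x + real n) * (real n / (x + real n)) * poly (class_prod ns) x"
    unfolding n by (simp add: Cons algebra_simps)
  also have "\<dots> = (x + real n) * poly (class_prod ns) x * (1 - (real n / (x + real n) + ?S))"
    by (simp only: right_diff_distrib distrib_left mult_ac mult_1_right)
  finally show ?case
    by (simp add: add.commute del: mp_poly.simps mult_pCons_left)
qed simp

lemma poly_mp_poly_0: "poly (mp_poly ns) 0 = real_of_nat (prod_list ns) * (1 - real (length ns))"
proof -
  have "poly (class_prod ns) 0 = real_of_nat (prod_list ns)" for ns
    by (induction ns) auto
  then show ?thesis
    by (induction ns) (simp_all add: right_diff_distrib)
qed

text \<open>Each term of the sum omits at most one of the t + 1 equal factors, so t of them can be
  pulled out. The t + 1 terms that omit one of them merge into a single term with coefficient (t +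
  1) n.\<close>

lemma mp_poly_replicate_append:
  "mp_poly (replicate (Suc t) n @ ns) = [:real n, 1:] ^ t *
     ([:real n, 1:] * mp_poly ns - Polynomial.smult (real (Suc t * n)) (class_prod ns))"
proof -
  have P: "class_prod (replicate t n @ ns) = [:real n, 1:] ^ t * class_prod ns" for t
    by (induction t) (simp_all add: mult.assoc del: mult_pCons_left)
  show ?thesis
  proof (induction t)
    case (Suc t)
    have "mp_poly (replicate (Suc (Suc t)) n @ ns)
        = [:real n, 1:] * mp_poly (replicate (Suc t) n @ ns)
          - Polynomial.smult (real n) (class_prod (replicate (Suc t) n @ ns))"
      by simp
    also have "\<dots> = [:real n, 1:] * ([:real n, 1:] ^ t *
     ([:real n, 1:] * mp_poly ns - Polynomial.smult (real (Suc t * n)) (class_prod ns)))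
         - Polynomial.smult (real n) ([:real n, 1:] ^ Suc t * class_prod ns)"
      unfolding Suc P ..
    also have "\<dots> = [:real n, 1:] ^ Suc t *
     ([:real n, 1:] * mp_poly ns - Polynomial.smult (real (Suc t * n)) (class_prod ns) - Polynomial.smult (real n) (class_prod ns))"
      by (simp add: algebra_simps del: mult_pCons_left mult_pCons_right)
    also have "[:real n, 1:] * mp_poly ns - Polynomial.smult (real (Suc t * n)) (class_prod ns) - Polynomial.smult (real n) (class_prod ns)
       = [:real n, 1:] * mp_poly ns - Polynomial.smult (real (Suc (Suc t) * n)) (class_prod ns)"
      by (simp add: smult_add_left[symmetric] algebra_simps del: mult_pCons_left mult_pCons_right smult_add_left)
    finally show ?case .
  qed simp
qed

text \<open>
  The quotient \<open>mp_poly ns / class_prod ns\<close> is \<open>1 - (\<Sum>n\<leftarrow>ns. n / (x + n))\<close>, whose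
  derivative is positive; below its numerator is treated without dividing.
\<close>

lemma mp_poly_wronskian_pos:
  assumes "0 \<notin> set ns" "- x \<notin> real ` set ns" "ns \<noteq> []"
  shows "poly (pderiv (mp_poly ns) * class_prod ns - mp_poly ns * pderiv (class_prod ns)) x > 0"
  using assms
proof (induction ns)
  case (Cons n ns)
  define W where
    "W ns = poly (pderiv (mp_poly ns) * class_prod ns - mp_poly ns * pderiv (class_prod ns)) x" for ns
  \<comment> \<open>A new class changes the quotient by -n / (x + n), whose derivative is n / (x +
    n)^2. The formula is this derivative with denominators cleared.\<close>
  have step: "W (n # ns) = (x + real n)\<^sup>2 * W ns + real n * (poly (class_prod ns) x)\<^sup>2"
  proof -
    have "poly (pderiv (mp_poly (n # ns))) x = poly (mp_poly ns) x
        + (x + real n) * poly (pderiv (mp_poly ns)) x - real n * poly (pderiv (class_prod ns)) x"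
      unfolding mp_poly.simps pderiv_diff pderiv_smult pderiv_mult poly_diff poly_add poly_mult poly_smult
      by (simp add: pderiv_pCons algebra_simps)
    moreover have "poly (pderiv (class_prod (n # ns))) x
        = poly (class_prod ns) x + (x + real n) * poly (pderiv (class_prod ns)) x"
      unfolding class_prod_simps pderiv_mult poly_add poly_mult
      by (simp add: pderiv_pCons algebra_simps)
    moreover have "poly (mp_poly (n # ns)) x
        = (x + real n) * poly (mp_poly ns) x - real n * poly (class_prod ns) x"
      "poly (class_prod (n # ns)) x = (x + real n) * poly (class_prod ns) x"
      by (simp_all add: algebra_simps)
    ultimately show ?thesis
      unfolding W_def poly_diff poly_mult by (simp only: power2_eq_square) (simp only: algebra_simps)
  qed
  have "W ns \<ge> 0"
    using Cons by (cases "ns = []") (auto simp: W_def less_imp_le)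
  moreover have "real n * (poly (class_prod ns) x)\<^sup>2 > 0"
    using Cons.prems by (auto simp: poly_class_prod_eq_0_iff)
  ultimately show ?case
    using step unfolding W_def by (metis add_nonneg_pos zero_le_mult_iff zero_le_power2)
qed simp

text \<open>At a multiple root both \<open>mp_poly ns\<close> and its derivative vanish, and then so
  does the expression that \<open>mp_poly_wronskian_pos\<close> shows to be positive.\<close>

lemma order_mp_poly_le_1:
  assumes "0 \<notin> set ns" "- x \<notin> real ` set ns"
  shows "order x (mp_poly ns) \<le> 1"
proof (cases "ns = []")
  case False
  show ?thesis
  proof (rule ccontr)
    assume "\<not> order x (mp_poly ns) \<le> 1"
    then have "[:- x, 1:]\<^sup>2 dvd mp_poly ns"
      by (intro order_divides[THEN iffD2]) auto
    then obtain r where r: "mp_poly ns = [:- x, 1:]\<^sup>2 * r"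
      by (auto elim: dvdE)
    have "poly (mp_poly ns) x = 0" "poly (pderiv (mp_poly ns)) x = 0"
      unfolding r by (simp_all add: power2_eq_square pderiv_mult pderiv_pCons del: mult_pCons_left)
    with mp_poly_wronskian_pos[OF assms False] show False
      by simp
  qed
qed simp

text \<open>The cofactor of the t-th power does not vanish at -n: its first summand does, while the
  second is a nonzero multiple of the product of all m - n with m in \<open>ns\<close>.\<close>

lemma order_mp_poly_replicate:
  assumes "n > 0" "n \<notin> set ns"
  shows "order (- real n) (mp_poly (replicate (Suc t) n @ ns)) = t"
proof -
  define r where "r = [:real n, 1:] * mp_poly ns - Polynomial.smult (real (Suc t * n)) (class_prod ns)"
  have r0: "poly r (- real n) \<noteq> 0"
  proof -
    have "real (Suc t * n) \<noteq> 0"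
      using assms(1) by (subst of_nat_eq_0_iff) simp
    then show ?thesis
      using assms(2) unfolding r_def by (auto simp: poly_class_prod_eq_0_iff)
  qed
  have "[:real n, 1:] ^ t * r \<noteq> 0"
    using r0 by auto
  then have "order (- real n) ([:real n, 1:] ^ t * r) = t"
    using order_mult[of "[:real n, 1:] ^ t" r "- real n"] order_power_n_n[of "- real n" t]
      order_0I[OF r0] by simp
  then show ?thesis
    unfolding mp_poly_replicate_append r_def .
qed

section \<open>Factorizations for the three families, and the triple 1, 1, 3\<close>

lemma mp_poly_pair: "mp_poly [l, m] = [:- sqrt (real l * real m), 1:] * [:sqrt (real l * real m), 1:]"
proof -
  have "sqrt (real l * real m) * sqrt (real l * real m) = real l * real m"
    by (rule real_sqrt_mult_self[THEN trans]) simp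
  then show ?thesis
    by (simp add: algebra_simps)
qed

lemma mp_poly_113: "mp_poly [1, 1, 3] = [:2, 1:] * [:1, 1:] * [:- 3, 1:]"
  by simp

lemma mp_poly_all_but_one_2:
  fixes k m :: nat
  assumes "k \<ge> 2"
  defines "s \<equiv> sqrt ((real k)\<^sup>2 + 2 * (real k - 1) * (real m - 2))"
  shows "mp_poly (replicate (k - 1) 2 @ [m])
    = [:2, 1:] ^ (k - 2) * ([:- (real k - 2 + s), 1:] * [:- (real k - 2 - s), 1:])"
proof -
  \<comment> \<open>This form shows that the radicand is nonnegative, so that squaring
    \<open>s\<close> gives it back.\<close>
  have "(real k)\<^sup>2 + 2 * (real k - 1) * (real m - 2) = (real k - 2)\<^sup>2 + 2 * (real k - 1) * real m"
    by (simp add: power2_eq_square algebra_simps)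
  also have "\<dots> \<ge> 0"
    using assms by simp
  finally have s2: "s * s = (real k)\<^sup>2 + 2 * (real k - 1) * (real m - 2)"
    unfolding s_def by simp
  have k: "k - 1 = Suc (k - 2)"
    using assms by simp
  have "real (k - 2) = real k - 2"
    using assms by (simp add: of_nat_diff)
  then have "[:real 2, 1:] * mp_poly [m] - Polynomial.smult (real (Suc (k - 2) * 2)) (class_prod [m])
      = [:- (real k - 2 + s), 1:] * [:- (real k - 2 - s), 1:]"
    using s2 by (simp add: algebra_simps power2_eq_square)
  then show ?thesis
    unfolding k mp_poly_replicate_append by (simp only: of_nat_numeral diff_Suc_1 Suc_diff_le)
qed

text \<open>With all sizes shifted by 2 the value at -2 is -2 (a'b'c' + a'b' + b'c' + c'a'). If a'
  were positive, so would be every term; as a' is neither 0 nor below -1, it is -1. What remains is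
  b' + c' = 0, and -1 <= b' <= c' with b' nonzero leaves only b' = -1, c' = 1.\<close>

lemma three_classes_root_minus_2:
  assumes "poly (mp_poly [a, b, c]) (- 2) = 0" "0 < a" "a \<le> b" "b \<le> c" "2 \<notin> {a, b, c}"
  shows "a = 1 \<and> b = 1 \<and> c = 3"
proof -
  define a' b' c' :: int where "a' = int a - 2" "b' = int b - 2" "c' = int c - 2"
  have "real_of_int (a' * b' * c' + a' * b' + b' * c' + c' * a') = 0"
    using assms(1) unfolding a'_b'_c'_def by (simp add: algebra_simps)
  then have eq: "a' * b' * c' + a' * b' + b' * c' + c' * a' = 0"
    by (simp only: of_int_eq_0_iff)
  have a': "a' = -1 \<or> a' \<ge> 1"
    using assms unfolding a'_b'_c'_def by auto
  have le: "a' \<le> b'" "b' \<le> c'" "b' \<noteq> 0"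
    using assms unfolding a'_b'_c'_def by auto
  from a' have "a' = -1"
  proof
    assume "a' \<ge> 1"
    then have "a' * b' * c' > 0" "a' * b' > 0" "b' * c' > 0" "c' * a' > 0"
      using le by simp_all
    with eq show ?thesis by linarith
  qed simp
  with eq have "b' = - c'"
    by simp
  with \<open>a' = -1\<close> le show ?thesis
    unfolding a'_b'_c'_def by linarith
qed

section \<open>Determinants and real symmetric matrices\<close>

text \<open>Sylvester's identity. Block elimination from the left by matrices of determinant 1
  clears either off-diagonal block of \<open>M\<close>: \<open>L\<close> leaves the Schur complement
  1 - VU, \<open>R\<close> leaves 1 - UV. It will reduce a determinant indexed by vertices to one
  indexed by classes.\<close>

lemma det_one_minus_mult_commute:
  fixes U V :: "'a :: idom mat"
  assumes U: "U \<in> carrier_mat n k" and V: "V \<in> carrier_mat k n"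
  shows "det (1\<^sub>m n - U * V) = det (1\<^sub>m k - V * U)"
proof -
  define M where "M = four_block_mat (1\<^sub>m n) U V (1\<^sub>m k)"
  have M: "M \<in> carrier_mat (n + k) (n + k)"
    unfolding M_def using U V by auto
  define L where "L = four_block_mat (1\<^sub>m n) (0\<^sub>m n k) (- V) (1\<^sub>m k)"
  define R where "R = four_block_mat (1\<^sub>m n) (- U) (0\<^sub>m k n) (1\<^sub>m k)"
  have L: "L \<in> carrier_mat (n + k) (n + k)" "det L = 1"
    unfolding L_def using U V by (auto simp: det_four_block_mat_upper_right_zero[of _ n _ k])
  have R: "R \<in> carrier_mat (n + k) (n + k)" "det R = 1"
    unfolding R_def using U V by (auto simp: det_four_block_mat_lower_left_zero[of _ n _ k])
  have "L * M = four_block_mat (1\<^sub>m n) U (0\<^sub>m k n) (1\<^sub>m k - V * U)"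
    unfolding L_def M_def
    using U V by (subst mult_four_block_mat[of _ n n _ k _ k _ _ n _ k])
      (auto intro!: cong_four_block_mat eq_matI)
  then have "det (L * M) = det (1\<^sub>m k - V * U)"
    using U V by (simp add: minus_carrier_mat det_four_block_mat_lower_left_zero[of _ n _ k])
  moreover have "R * M = four_block_mat (1\<^sub>m n - U * V) (0\<^sub>m n k) V (1\<^sub>m k)"
    unfolding R_def M_def
    using U V by (subst mult_four_block_mat[of _ n n _ k _ k _ _ n _ k])
      (auto intro!: cong_four_block_mat eq_matI)
  then have "det (R * M) = det (1\<^sub>m n - U * V)"
    using U V by (simp add: minus_carrier_mat det_four_block_mat_upper_right_zero[of _ n _ k])
  ultimately show ?thesis
    using L R M by (simp add: det_mult[of _ "n + k"])
qed

text \<open>Taking out the diagonal matrix leaves the identity minus a column times a row, and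
  Sylvester's identity turns its determinant into that of a 1 by 1 matrix.\<close>

lemma det_diagonal_minus_rank_one:
  fixes f u w :: "nat \<Rightarrow> 'a :: field"
  assumes "\<And>i. i < k \<Longrightarrow> f i \<noteq> 0"
  shows "det (mat k k (\<lambda>(i, j). (if i = j then f i else 0) - u i * w j))
    = (\<Prod>i<k. f i) * (1 - (\<Sum>i<k. w i * u i / f i))"
proof -
  define F where "F = mat k k (\<lambda>(i, j). if i = j then f i else 0)"
  define u' w' where "u' = mat k 1 (\<lambda>(i, j). u i / f i)" "w' = mat 1 k (\<lambda>(i, j). w j)"
  have "det F = prod_list (diag_mat F)"
    by (rule det_upper_triangular[of _ k]) (auto simp: F_def)
  also have "\<dots> = (\<Prod>i<k. f i)"
    unfolding prod_list_diag_prod by (simp add: F_def atLeast0LessThan)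
  finally have F: "det F = (\<Prod>i<k. f i)" .
  have "mat k k (\<lambda>(i, j). (if i = j then f i else 0) - u i * w j) = F * (1\<^sub>m k - u' * w')"
  proof (rule eq_matI)
    fix i j assume "i < dim_row (F * (1\<^sub>m k - u' * w'))" "j < dim_col (F * (1\<^sub>m k - u' * w'))"
    then have ij: "i < k" "j < k"
      by (auto simp: F_def u'_w'_def)
    have X: "(1\<^sub>m k - u' * w') $$ (l, j) = (if l = j then 1 else 0) - u l / f l * w j" if "l < k" for l
      using ij that by (simp add: u'_w'_def scalar_prod_def)
    have "(F * (1\<^sub>m k - u' * w')) $$ (i, j)
        = (\<Sum>l = 0..<k. F $$ (i, l) * (1\<^sub>m k - u' * w') $$ (l, j))"
      using ij by (simp add: F_def u'_w'_def scalar_prod_def)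
    also have "\<dots> = (\<Sum>l = 0..<k. if i = l then f i * ((if i = j then 1 else 0) - u i / f i * w j) else 0)"
      by (intro sum.cong refl, subst X) (use ij in \<open>auto simp: F_def\<close>)
    also have "\<dots> = f i * ((if i = j then 1 else 0) - u i / f i * w j)"
      using ij by simp
    also have "\<dots> = (if i = j then f i else 0) - u i * w j"
      using assms ij by (simp add: field_simps)
    finally show "mat k k (\<lambda>(i, j). (if i = j then f i else 0) - u i * w j) $$ (i, j)
        = (F * (1\<^sub>m k - u' * w')) $$ (i, j)"
      using ij by simp
  qed (auto simp: F_def u'_w'_def)
  moreover have "det (F * (1\<^sub>m k - u' * w')) = det F * det (1\<^sub>m k - u' * w')"
    by (rule det_mult[of _ k]) (auto simp: F_def u'_w'_def)
  moreover have "det (1\<^sub>m k - u' * w') = det (1\<^sub>m 1 - w' * u')"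
    by (rule det_one_minus_mult_commute) (auto simp: u'_w'_def)
  moreover have "det (1\<^sub>m 1 - w' * u') = 1 - (\<Sum>i<k. w i * u i / f i)"
    by (subst det_single) (auto simp: u'_w'_def scalar_prod_def atLeast0LessThan)
  ultimately show ?thesis
    using F by simp
qed

section \<open>Spectral theorem for real symmetric matrices\<close>

lemma real_scalar_prod_self:
  fixes v :: "real vec"
  assumes "v \<in> carrier_vec n"
  shows "v \<bullet> v \<ge> 0" "v \<bullet> v = 0 \<longleftrightarrow> v = 0\<^sub>v n"
proof -
  have eq: "v \<bullet> v = (\<Sum>i = 0..<n. (v $ i)\<^sup>2)"
    using assms by (simp add: scalar_prod_def power2_eq_square)
  show "v \<bullet> v \<ge> 0"
    unfolding eq by (simp add: sum_nonneg)
  show "v \<bullet> v = 0 \<longleftrightarrow> v = 0\<^sub>v n"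
    unfolding eq using assms by (auto simp: sum_nonneg_eq_0_iff intro!: eq_vecI)
qed

text \<open>A complex eigenvector z = x + iy for the eigenvalue c exists because the characteristic
  polynomial splits over the complex numbers. Symmetry forces c to be real, and then x or y is a
  real eigenvector.\<close>

lemma real_symmetric_eigenvalue_exists:
  fixes A :: "real mat"
  assumes A: "A \<in> carrier_mat n n" and sym: "A\<^sup>T = A" and "n > 0"
  shows "\<exists>x v. eigenvector A v x"
proof -
  let ?C = "map_mat complex_of_real A"
  have C: "?C \<in> carrier_mat n n"
    using A by simp
  obtain as where as: "char_poly ?C = (\<Prod>a\<leftarrow>as. [:- a, 1:])" "length as = n"
    using char_poly_factorized[OF C] by blast
  then obtain c where "c \<in> set as"
    using \<open>n > 0\<close> by (cases as) auto
  then have "poly (char_poly ?C) c = 0"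
    unfolding as(1) poly_prod_list by (force simp: prod_list_zero_iff)
  then obtain z where z: "z \<in> carrier_vec n" "z \<noteq> 0\<^sub>v n" "?C *\<^sub>v z = c \<cdot>\<^sub>v z"
    using eigenvalue_root_char_poly[OF C] A unfolding eigenvalue_def eigenvector_def by auto
  define x y where "x = map_vec Re z" "y = map_vec Im z"
  have xy: "x \<in> carrier_vec n" "y \<in> carrier_vec n"
    using z unfolding x_y_def by auto
  have row: "(\<Sum>j = 0..<n. of_real (A $$ (i, j)) * z $ j) = c * z $ i" if "i < n" for i
    using arg_cong[OF z(3), of "\<lambda>v. v $ i"] that A z(1) by (simp add: scalar_prod_def)
  have Ax: "A *\<^sub>v x = Re c \<cdot>\<^sub>v x - Im c \<cdot>\<^sub>v y"
  proof (rule eq_vecI)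
    fix i assume "i < dim_vec (Re c \<cdot>\<^sub>v x - Im c \<cdot>\<^sub>v y)"
    then have "i < n" using xy by simp
    with arg_cong[OF row[OF this], of Re] A z(1) show "(A *\<^sub>v x) $ i = (Re c \<cdot>\<^sub>v x - Im c \<cdot>\<^sub>v y) $ i"
      by (simp add: scalar_prod_def x_y_def)
  qed (use A xy in auto)
  have Ay: "A *\<^sub>v y = Re c \<cdot>\<^sub>v y + Im c \<cdot>\<^sub>v x"
  proof (rule eq_vecI)
    fix i assume "i < dim_vec (Re c \<cdot>\<^sub>v y + Im c \<cdot>\<^sub>v x)"
    then have "i < n" using xy by simp
    with arg_cong[OF row[OF this], of Im] A z(1) show "(A *\<^sub>v y) $ i = (Re c \<cdot>\<^sub>v y + Im c \<cdot>\<^sub>v x) $ i"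
      by (simp add: scalar_prod_def x_y_def)
  qed (use A xy in auto)
  have nz: "x \<noteq> 0\<^sub>v n \<or> y \<noteq> 0\<^sub>v n"
  proof (rule ccontr)
    assume *: "\<not> ?thesis"
    have "z $ i = 0" if "i < n" for i
    proof -
      have "x $ i = 0" "y $ i = 0"
        using * that by auto
      then show ?thesis
        using z(1) that by (simp add: x_y_def complex_eq_iff)
    qed
    then show False
      using z by (auto intro!: eq_vecI)
  qed
  \<comment> \<open>The terms with Re c agree on both sides; only those with Im c survive.\<close>
  have "x \<bullet> (A *\<^sub>v y) = (A *\<^sub>v x) \<bullet> y"
    using transpose_vec_mult_scalar[OF A xy(2) xy(1)] sym by simp
  then have "Im c * (x \<bullet> x + y \<bullet> y) = 0"
    unfolding Ax Ay using xy
    by (simp add: scalar_prod_add_distrib[of _ n] minus_scalar_prod_distrib[of _ n]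
        comm_scalar_prod[of x n y] algebra_simps)
  moreover have "x \<bullet> x + y \<bullet> y > 0"
    using nz real_scalar_prod_self[OF xy(1)] real_scalar_prod_self[OF xy(2)] by linarith
  ultimately have "Im c = 0"
    by simp
  with Ax Ay xy A have "A *\<^sub>v x = Re c \<cdot>\<^sub>v x" "A *\<^sub>v y = Re c \<cdot>\<^sub>v y"
    by auto
  with nz xy A show ?thesis
    unfolding eigenvector_def by auto
qed

text \<open>The reflection in the hyperplane orthogonal to w = v - e exchanges the two vectors,
  since they have equal length. It provides a symmetric orthogonal matrix with a prescribed image of
  e without any orthonormalization of a basis. For v = e there is no such hyperplane and the
  identity serves.\<close>

lemma householder_reflection:
  fixes e v :: "real vec"
  assumes e: "e \<in> carrier_vec n" "e \<bullet> e = 1" and v: "v \<in> carrier_vec n" "v \<bullet> v = 1"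
  shows "\<exists>H \<in> carrier_mat n n. H\<^sup>T = H \<and> H * H = 1\<^sub>m n \<and> H *\<^sub>v e = v"
proof (cases "v = e")
  case True
  then show ?thesis
    using e by (intro bexI[of _ "1\<^sub>m n"]) auto
next
  case False
  define w where "w = v - e"
  have w: "w \<in> carrier_vec n" "w \<noteq> 0\<^sub>v n"
    using e v False unfolding w_def by (auto simp: vec_eq_iff)
  define t where "t = 2 / (w \<bullet> w)"
  have t: "t * (w \<bullet> w) = 2"
    using real_scalar_prod_self(2)[OF w(1)] w(2) by (simp add: t_def)
  have we: "w \<bullet> e = v \<bullet> e - 1" "w \<bullet> w = 2 - 2 * (v \<bullet> e)"
    using e v comm_scalar_prod[OF e(1) v(1)] unfolding w_def
    by (simp_all add: minus_scalar_prod_distrib[of _ n] scalar_prod_minus_distrib[of _ n])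
  \<comment> \<open>Here the equal lengths enter: t (w . e) = -1 follows, so H e = e + w =
    v.\<close>
  then have ww: "w \<bullet> w = - 2 * (w \<bullet> e)"
    by simp
  have te: "t * (w \<bullet> e) = - 1"
    using t unfolding ww by simp
  have sums: "(\<Sum>l = 0..<n. w $ l * w $ l) = w \<bullet> w" "(\<Sum>l = 0..<n. w $ l * e $ l) = w \<bullet> e"
    using w e by (simp_all add: scalar_prod_def)
  define H where "H = mat n n (\<lambda>(i, j). (if i = j then 1 else 0) - t * w $ i * w $ j)"
  have "H * H = 1\<^sub>m n"
  proof (rule eq_matI)
    fix i j assume "i < dim_row (1\<^sub>m n :: real mat)" "j < dim_col (1\<^sub>m n :: real mat)"
    then have ij: "i < n" "j < n"
      by auto
    have "(H * H) $$ (i, j) = (\<Sum>l = 0..<n. ((if i = l then 1 else 0) - t * w $ i * w $ l)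
        * ((if l = j then 1 else 0) - t * w $ l * w $ j))"
      using ij by (simp add: H_def scalar_prod_def)
    also have "\<dots> = (\<Sum>l = 0..<n. (if i = l then (if l = j then 1 else 0) - t * w $ l * w $ j else 0)
        - (if l = j then t * w $ i * w $ l else 0) + t * t * w $ i * w $ j * (w $ l * w $ l))"
      by (intro sum.cong) (auto simp: algebra_simps)
    also have "\<dots> = ((if i = j then 1 else 0) - t * w $ i * w $ j) - t * w $ i * w $ j
        + t * t * w $ i * w $ j * (w \<bullet> w)"
      using ij by (simp add: sum.distrib sum_subtractf sum_distrib_left[symmetric] sums)
    also have "t * t * w $ i * w $ j * (w \<bullet> w) = t * w $ i * w $ j * (t * (w \<bullet> w))"
      by simp
    finally show "(H * H) $$ (i, j) = 1\<^sub>m n $$ (i, j)"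
      unfolding t using ij by simp
  qed (auto simp: H_def)
  moreover have "H *\<^sub>v e = v"
  proof (rule eq_vecI)
    fix i assume "i < dim_vec v"
    then have i: "i < n"
      using v by auto
    have "(H *\<^sub>v e) $ i = (\<Sum>l = 0..<n. ((if i = l then 1 else 0) - t * w $ i * w $ l) * e $ l)"
      using i e by (simp add: H_def scalar_prod_def)
    also have "\<dots> = (\<Sum>l = 0..<n. (if i = l then e $ l else 0) - t * w $ i * (w $ l * e $ l))"
      by (intro sum.cong) (auto simp: algebra_simps)
    also have "\<dots> = e $ i - t * w $ i * (w \<bullet> e)"
      using i by (simp add: sum_subtractf sum_distrib_left[symmetric] sums)
    also have "\<dots> = e $ i - w $ i * (t * (w \<bullet> e))"
      by simp
    finally show "(H *\<^sub>v e) $ i = v $ i"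
      unfolding te using i e v by (simp add: w_def)
  qed (use v in \<open>auto simp: H_def\<close>)
  moreover have "H\<^sup>T = H"
    by (rule eq_matI) (auto simp: H_def)
  ultimately show ?thesis
    by (intro bexI[of _ H]) (auto simp: H_def)
qed

text \<open>Orthogonality of \<open>P\<close> is expressed by letting its transpose be the inverse
  in \<open>similar_mat_wit\<close>. A reflection that moves the first unit vector to a unit
  eigenvector splits off one eigenvalue, and induction treats the remaining symmetric block.\<close>

lemma real_symmetric_diagonalization:
  fixes A :: "real mat"
  assumes "A \<in> carrier_mat n n" "A\<^sup>T = A"
  shows "\<exists>P D. similar_mat_wit A D P P\<^sup>T \<and> diagonal_mat D"
  using assms
proof (induction n arbitrary: A)
  case 0
  then show ?case
    using similar_mat_wit_refl[OF 0(1)]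
    by (intro exI[of _ "1\<^sub>m 0"] exI[of _ A]) (auto simp: diagonal_mat_def)
next
  case (Suc n)
  note A = Suc.prems
  obtain x u where u: "u \<in> carrier_vec (Suc n)" "u \<noteq> 0\<^sub>v (Suc n)" "A *\<^sub>v u = x \<cdot>\<^sub>v u"
    using real_symmetric_eigenvalue_exists[OF A] A(1) unfolding eigenvector_def by auto
  define v where "v = (1 / sqrt (u \<bullet> u)) \<cdot>\<^sub>v u"
  have v: "v \<in> carrier_vec (Suc n)" "A *\<^sub>v v = x \<cdot>\<^sub>v v"
    using u A unfolding v_def by (auto simp: mult_mat_vec smult_smult_assoc mult.commute)
  have "v \<bullet> v = 1"
    using u real_scalar_prod_self[OF u(1)] unfolding v_def by simp
  moreover define e :: "real vec" where "e = unit_vec (Suc n) 0"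
  then have e: "e \<in> carrier_vec (Suc n)" "e \<bullet> e = 1"
    by simp_all
  ultimately obtain H where H: "H \<in> carrier_mat (Suc n) (Suc n)" "H\<^sup>T = H" "H * H = 1\<^sub>m (Suc n)"
      "H *\<^sub>v e = v"
    using householder_reflection[of e "Suc n" v] v by blast
  define B where "B = H * A * H"
  have B: "B \<in> carrier_mat (Suc n) (Suc n)"
    using A H unfolding B_def by auto
  have sim1: "similar_mat_wit A B H H"
  proof (rule similar_mat_wit_sym, rule similar_mat_witI[of _ _ "Suc n"])
    show "B = H * A * H" by (fact B_def)
  qed (use A B H in auto)
  have symB: "B\<^sup>T = B"
    using A H unfolding B_def
    by (simp add: transpose_mult[of _ "Suc n" "Suc n" _ "Suc n"] assoc_mult_mat[of _ "Suc n" "Suc n" _ "Suc n" _ "Suc n"])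
  have "B *\<^sub>v e = H *\<^sub>v (A *\<^sub>v (H *\<^sub>v e))"
    using A H e unfolding B_def
    by (simp add: assoc_mult_mat_vec[of _ "Suc n" "Suc n" _ "Suc n"])
  also have "\<dots> = x \<cdot>\<^sub>v (H *\<^sub>v (H *\<^sub>v e))"
    using H v by (simp add: mult_mat_vec)
  also have "H *\<^sub>v (H *\<^sub>v e) = e"
    using H e assoc_mult_mat_vec[OF H(1) H(1) e(1)] by simp
  finally have Be: "B *\<^sub>v e = x \<cdot>\<^sub>v e" .
  \<comment> \<open>The first unit vector is now an eigenvector, which fixes the first column of
    \<open>B\<close>; symmetry then fixes the first row.\<close>
  have col0: "B $$ (i, 0) = (if i = 0 then x else 0)" if "i < Suc n" for i
    using arg_cong[OF Be, of "\<lambda>y. y $ i"] that B unfolding e_def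
    by (simp add: scalar_prod_right_unit)
  have row0: "B $$ (0, i) = (if i = 0 then x else 0)" if "i < Suc n" for i
    using arg_cong[OF symB, of "\<lambda>M. M $$ (i, 0)"] col0[OF that] B that by simp
  define X where "X = mat 1 1 (\<lambda>_. x)"
  define A' where "A' = mat n n (\<lambda>(i, j). B $$ (Suc i, Suc j))"
  have A': "A' \<in> carrier_mat n n" "A'\<^sup>T = A'"
  proof -
    have "B $$ (Suc j, Suc i) = B $$ (Suc i, Suc j)" if "i < n" "j < n" for i j
      using arg_cong[OF symB, of "\<lambda>M. M $$ (Suc i, Suc j)"] B that by simp
    then show "A'\<^sup>T = A'"
      by (intro eq_matI) (auto simp: A'_def)
  qed (simp add: A'_def)
  have Bblock: "B = four_block_mat X (0\<^sub>m 1 n) (0\<^sub>m n 1) A'"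
    using B col0 row0 by (intro eq_matI) (auto simp: X_def A'_def)
  obtain P' D' where IH: "similar_mat_wit A' D' P' P'\<^sup>T" "diagonal_mat D'"
    using Suc.IH[OF A'] by blast
  note wit = similar_mat_witD2[OF A'(1) IH(1)]
  define R where "R = four_block_mat (1\<^sub>m 1) (0\<^sub>m 1 n) (0\<^sub>m n 1) P'"
  define D where "D = four_block_mat X (0\<^sub>m 1 n) (0\<^sub>m n 1) D'"
  have "X \<in> carrier_mat 1 1"
    by (simp add: X_def)
  then have "similar_mat_wit (four_block_mat X (0\<^sub>m 1 n) (0\<^sub>m n 1) A') (four_block_mat X (0\<^sub>m 1 n) (0\<^sub>m n 1) D')
     (four_block_mat (1\<^sub>m 1) (0\<^sub>m 1 n) (0\<^sub>m n 1) P') (four_block_mat (1\<^sub>m 1) (0\<^sub>m 1 n) (0\<^sub>m n 1) P'\<^sup>T)"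
    using wit A' by (intro similar_mat_wit_four_block[OF similar_mat_wit_refl IH(1)]) auto
  moreover have "R\<^sup>T = four_block_mat (1\<^sub>m 1) (0\<^sub>m 1 n) (0\<^sub>m n 1) P'\<^sup>T"
    unfolding R_def using wit by (subst transpose_four_block_mat[of _ 1 1 _ n _ n]) auto
  ultimately have sim2: "similar_mat_wit B D R R\<^sup>T"
    unfolding Bblock D_def R_def by simp
  have "R \<in> carrier_mat (Suc n) (Suc n)"
    unfolding R_def using wit by auto
  then have "(H * R)\<^sup>T = R\<^sup>T * H"
    using H by (simp add: transpose_mult[of _ "Suc n" "Suc n" _ "Suc n"])
  then have "similar_mat_wit A D (H * R) (H * R)\<^sup>T"
    using similar_mat_wit_trans[OF sim1 sim2] by simp
  moreover have "diagonal_mat D"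
    using IH(2) wit unfolding D_def diagonal_mat_def X_def by auto
  ultimately show ?case
    by blast
qed

lemma diagonal_mat_char_poly:
  assumes "D \<in> carrier_mat n n" "diagonal_mat D"
  shows "char_poly D = (\<Prod>i<n. [:- D $$ (i, i), 1:])"
proof -
  have "char_poly D = (\<Prod>a\<leftarrow>diag_mat D. [:- a, 1:])"
    using assms by (intro char_poly_upper_triangular[of _ n]) (auto simp: diagonal_mat_def)
  then show ?thesis
    using assms(1) by (simp add: diag_mat_def interv_sum_list_conv_sum_set_nat comp_def
      prod.distinct_set_conv_list[symmetric] atLeast0LessThan)
qed

lemma real_symmetric_proots:
  fixes A :: "real mat"
  assumes A: "A \<in> carrier_mat n n" and sym: "A\<^sup>T = A"
  obtains P D where "P \<in> carrier_mat n n" "D \<in> carrier_mat n n" "diagonal_mat D" "A = P * D * P\<^sup>T"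
    "proots (char_poly A) = {#D $$ (i, i). i \<in># mset_set {..<n}#}"
proof -
  obtain P D where PD: "similar_mat_wit A D P P\<^sup>T" "diagonal_mat D"
    using real_symmetric_diagonalization[OF A sym] by blast
  note wit = similar_mat_witD2[OF A PD(1)]
  have "char_poly A = (\<Prod>i<n. [:- D $$ (i, i), 1:])"
    using char_poly_similar[of A D] PD diagonal_mat_char_poly[of D n] wit
    unfolding similar_mat_def by auto
  then have "proots (char_poly A) = (\<Sum>i<n. {#D $$ (i, i)#})"
    by (simp add: proots_prod)
  also have "\<dots> = {#D $$ (i, i). i \<in># mset_set {..<n}#}"
    by (simp add: sum_unfold_sum_mset)
  finally show thesis
    using that wit PD by blast
qed

text \<open>Let p be the column of P that belongs to the positive eigenvalue. In the coordinates d =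
  P^T c the form is a sum of eigenvalues times squares, and orthogonality to p removes the only
  square with a positive coefficient.\<close>

lemma real_symmetric_one_pos:
  fixes A :: "real mat"
  assumes A: "A \<in> carrier_mat n n" and sym: "A\<^sup>T = A"
    and pos: "size {#x \<in># proots (char_poly A). x > 0#} \<le> 1"
  shows "\<exists>p \<in> carrier_vec n. \<forall>c \<in> carrier_vec n. p \<bullet> c = 0 \<longrightarrow> c \<bullet> (A *\<^sub>v c) \<le> 0"
proof -
  obtain P D where PD: "P \<in> carrier_mat n n" "D \<in> carrier_mat n n" "diagonal_mat D" "A = P * D * P\<^sup>T"
    "proots (char_poly A) = {#D $$ (i, i). i \<in># mset_set {..<n}#}"
    using real_symmetric_proots[OF A sym] by blast
  define I where "I = {i. i < n \<and> D $$ (i, i) > 0}"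
  have "size {#x \<in># proots (char_poly A). x > 0#} = card I"
    unfolding PD(5) filter_mset_image_mset by (simp add: I_def filter_mset_mset_set Collect_conj_eq lessThan_def)
  with pos have I1: "card I \<le> 1"
    by simp
  have "\<exists>k. I \<subseteq> {k}"
    using I1 card_le_Suc0_iff_eq[of I] by (cases "I = {}") (auto simp: I_def)
  then obtain k where k: "I \<subseteq> {k}" by blast
  \<comment> \<open>If there is no positive eigenvalue, \<open>k\<close> is arbitrary and may lie
    outside the index range; the zero vector covers that case.\<close>
  define p where "p = (if k < n then col P k else 0\<^sub>v n)"
  have p: "p \<in> carrier_vec n"
    using PD by (auto simp: p_def)
  have "c \<bullet> (A *\<^sub>v c) \<le> 0" if c: "c \<in> carrier_vec n" "p \<bullet> c = 0" for c
  proof -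
    define d where "d = P\<^sup>T *\<^sub>v c"
    have d: "d \<in> carrier_vec n" "\<And>i. i < n \<Longrightarrow> d $ i = col P i \<bullet> c"
      using PD c by (auto simp: d_def)
    have "c \<bullet> (A *\<^sub>v c) = c \<bullet> (P *\<^sub>v (D *\<^sub>v d))"
      unfolding PD(4) d_def using PD c by (simp add: assoc_mult_mat_vec[of _ n n _ n])
    also have "\<dots> = d \<bullet> (D *\<^sub>v d)"
      unfolding d_def using PD c by (subst transpose_vec_mult_scalar[of P n n]) auto
    also have "\<dots> = (\<Sum>i = 0..<n. d $ i * (D *\<^sub>v d) $ i)"
      using d PD by (simp add: scalar_prod_def)
    also have "\<dots> = (\<Sum>i = 0..<n. D $$ (i, i) * (d $ i)\<^sup>2)"
    proof (rule sum.cong)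
      fix i assume "i \<in> {0..<n}"
      then have i: "i < n" by simp
      have "(D *\<^sub>v d) $ i = (\<Sum>j = 0..<n. D $$ (i, j) * d $ j)"
        using i d PD by (simp add: scalar_prod_def)
      also have "\<dots> = (\<Sum>j = 0..<n. if i = j then D $$ (i, i) * d $ i else 0)"
        using PD i by (intro sum.cong) (auto simp: diagonal_mat_def)
      finally show "d $ i * (D *\<^sub>v d) $ i = D $$ (i, i) * (d $ i)\<^sup>2"
        using i by (simp add: power2_eq_square)
    qed simp
    also have "\<dots> \<le> 0"
    proof (rule sum_nonpos)
      fix i assume "i \<in> {0..<n}"
      then have i: "i < n" by simp
      show "D $$ (i, i) * (d $ i)\<^sup>2 \<le> 0"
      proof (cases "i = k")
        case True
        then show ?thesis
          using d(2)[OF i] c i by (simp add: p_def)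
      next
        case False
        then have "D $$ (i, i) \<le> 0"
          using k i unfolding I_def by force
        then show ?thesis
          by (simp add: mult_nonpos_nonneg)
      qed
    qed
    finally show ?thesis .
  qed
  with p show ?thesis
    by blast
qed

section \<open>Complete multipartite graphs\<close>

text \<open>The classes form a list because \<open>complete_multipartite\<close> and
  \<open>mp_poly\<close> take lists of sizes. Excluding the empty class makes the length of the list
  the true number of classes.\<close>

definition multipartition :: "'a pair_pre_digraph \<Rightarrow> 'a set list \<Rightarrow> bool" where
  "multipartition G cs \<longleftrightarrow> distinct cs \<and> {} \<notin> set cs \<and> pairwise disjnt (set cs) \<and>
     \<Union> (set cs) = pverts G \<and>
     parcs G = {(u, v). u \<in> pverts G \<and> v \<in> pverts G \<and> (\<forall>X\<in>set cs. u \<in> X \<longrightarrow> v \<notin> X)}"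

lemma multipartition_cong:
  "multipartition G cs \<Longrightarrow> distinct ds \<Longrightarrow> set ds = set cs \<Longrightarrow> multipartition G ds"
  unfolding multipartition_def by simp

lemma pair_graph_parcs:
  assumes "pair_graph G"
  shows "(a, b) \<in> parcs G \<longleftrightarrow> (b, a) \<in> parcs G" "(a, a) \<notin> parcs G"
    "(a, b) \<in> parcs G \<Longrightarrow> a \<in> pverts G \<and> b \<in> pverts G"
proof -
  interpret pair_graph G by fact
  show "(a, b) \<in> parcs G \<longleftrightarrow> (b, a) \<in> parcs G"
    using pair_sym_arcs unfolding symmetric_def by (auto dest: symD)
  show "(a, a) \<notin> parcs G"
    using pair_no_loops[of "(a, a)"] by auto
  show "(a, b) \<in> parcs G \<Longrightarrow> a \<in> pverts G \<and> b \<in> pverts G"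
    using arc_fst_in_verts[of "(a, b)"] arc_snd_in_verts[of "(a, b)"] by auto
qed

lemma multipartition_digraph_iso:
  assumes G: "pair_graph G" and mp: "multipartition G cs"
  shows "digraph_iso (with_proj G) (with_proj (complete_multipartite (map card cs)))"
proof -
  interpret pair_graph G by fact
  have fin: "finite X" if "X \<in> set cs" for X
    using mp that pair_finite_verts unfolding multipartition_def by (metis Union_upper finite_subset)
  have "\<forall>X\<in>set cs. \<exists>h. bij_betw h X {0..<card X}"
    using ex_bij_betw_finite_nat[OF fin] by blast
  then obtain h where h: "\<And>X. X \<in> set cs \<Longrightarrow> bij_betw (h X) X {0..<card X}"
    by metis
  have "\<forall>v\<in>pverts G. \<exists>i<length cs. v \<in> cs ! i"
    using mp unfolding multipartition_def by (metis UnionE in_set_conv_nth)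
  then obtain idx where idx: "\<And>v. v \<in> pverts G \<Longrightarrow> idx v < length cs \<and> v \<in> cs ! idx v"
    by metis
  have disj: "X = Y" if "X \<in> set cs" "Y \<in> set cs" "v \<in> X" "v \<in> Y" for X Y v
    using mp that unfolding multipartition_def pairwise_def disjnt_def by blast
  have mem: "v \<in> pverts G \<and> idx v = i" if "i < length cs" "v \<in> cs ! i" for v i
  proof -
    have v: "v \<in> pverts G"
      using mp that unfolding multipartition_def by (metis UnionI nth_mem)
    have "cs ! idx v = cs ! i"
      using disj[of "cs ! idx v" "cs ! i" v] idx[OF v] that by simp
    moreover have "distinct cs"
      using mp by (simp add: multipartition_def)
    ultimately show ?thesis
      using v idx[OF v] that(1) by (metis nth_eq_iff_index_eq)
  qed
  have arc: "(u, v) \<in> parcs G \<longleftrightarrow> u \<in> pverts G \<and> v \<in> pverts G \<and> idx u \<noteq> idx v" for u v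
  proof -
    have "(\<forall>X\<in>set cs. u \<in> X \<longrightarrow> v \<notin> X) \<longleftrightarrow> idx u \<noteq> idx v" if "u \<in> pverts G" "v \<in> pverts G"
      using idx[OF that(1)] idx[OF that(2)] mem by (metis in_set_conv_nth)
    then show ?thesis
      using mp unfolding multipartition_def by auto
  qed
  \<comment> \<open>A vertex goes to the position of its class and its number within the class under
    a chosen bijection.\<close>
  define f where "f v = (idx v, h (cs ! idx v) v)" for v
  have inj: "inj_on f (pverts G)"
  proof (rule inj_onI)
    fix u v assume uv: "u \<in> pverts G" "v \<in> pverts G" "f u = f v"
    then have "idx u = idx v" "h (cs ! idx u) u = h (cs ! idx u) v"
      unfolding f_def by auto
    then show "u = v"
      using h[of "cs ! idx u"] idx[OF uv(1)] idx[OF uv(2)]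
      by (metis bij_betw_inv_into_left nth_mem)
  qed
  define V where "V = {(i, j). i < length cs \<and> j < card (cs ! i)}"
  have image: "f ` pverts G = V"
  proof (intro equalityI subsetI)
    fix y assume "y \<in> f ` pverts G"
    then obtain v where v: "v \<in> pverts G" "y = f v" by blast
    then have "h (cs ! idx v) v \<in> {0..<card (cs ! idx v)}"
      using idx[OF v(1)] h[of "cs ! idx v"] by (metis bij_betwE nth_mem)
    then show "y \<in> V"
      using idx[OF v(1)] unfolding v V_def f_def by simp
  next
    fix y assume "y \<in> V"
    then obtain i j where y: "y = (i, j)" "i < length cs" "j < card (cs ! i)"
      unfolding V_def by auto
    then obtain v where v: "v \<in> cs ! i" "h (cs ! i) v = j"
      using h[of "cs ! i"] unfolding bij_betw_def by (metis atLeastLessThan_iff imageE nth_mem zero_le)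
    then have "f v = y" "v \<in> pverts G"
      using mem[OF y(2) v(1)] y by (auto simp: f_def)
    then show "y \<in> f ` pverts G"
      by blast
  qed
  have parcs_image: "map_prod f f ` parcs G = {(a, b). a \<in> V \<and> b \<in> V \<and> fst a \<noteq> fst b}"
  proof (intro equalityI subsetI)
    fix e assume "e \<in> map_prod f f ` parcs G"
    then show "e \<in> {(a, b). a \<in> V \<and> b \<in> V \<and> fst a \<noteq> fst b}"
      using image arc by (auto simp: f_def)
  next
    fix e assume "e \<in> {(a, b). a \<in> V \<and> b \<in> V \<and> fst a \<noteq> fst b}"
    then obtain u v where "e = (f u, f v)" "u \<in> pverts G" "v \<in> pverts G" "fst (f u) \<noteq> fst (f v)"
      unfolding image[symmetric] by auto
    then show "e \<in> map_prod f f ` parcs G"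
      using arc[of u v] by (auto simp: f_def intro!: image_eqI[of _ _ "(u, v)"])
  qed
  define F where "F = \<lparr>iso_verts = f, iso_arcs = map_prod f f, iso_head = snd, iso_tail = fst\<rparr>"
  have "inj_on (map_prod f f) (parcs G)"
  proof (rule inj_onI)
    fix e e' assume "e \<in> parcs G" "e' \<in> parcs G" "map_prod f f e = map_prod f f e'"
    then show "e = e'"
      using inj arc by (cases e; cases e') (auto dest: inj_onD)
  qed
  then have "digraph_isomorphism F"
    unfolding digraph_isomorphism_def F_def using inj wf_digraph_axioms by simp
  moreover have "with_proj (complete_multipartite (map card cs)) = app_iso F (with_proj G)"
  proof -
    have V': "{(i, j). i < length (map card cs) \<and> j < map card cs ! i} = V"
      unfolding V_def by auto
    show ?thesis
      unfolding complete_multipartite_def Let_def V' app_iso_def F_def with_proj_def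
      using image parcs_image by simp
  qed
  ultimately show ?thesis
    unfolding digraph_iso_def by blast
qed

section \<open>One positive eigenvalue forces a complete multipartite graph\<close>

text \<open>This is \<open>real_symmetric_one_pos\<close> for functions on the vertices, so that
  later test vectors can be given by naming vertices instead of positions in an enumeration.\<close>

lemma adjacency_form_hyperplane:
  fixes G :: "'a pair_pre_digraph"
  assumes G: "pair_graph G" and pos: "size {#x \<in># adj_spectrum G. x > 0#} \<le> 1"
  obtains q :: "'a \<Rightarrow> real" where "\<And>g. (\<Sum>a\<in>pverts G. q a * g a) = 0 \<Longrightarrow>
     (\<Sum>a\<in>pverts G. \<Sum>b\<in>pverts G. if (a, b) \<in> parcs G then g a * g b else 0) \<le> 0"
proof -
  interpret pair_graph G by fact
  obtain vs where vs: "distinct vs" "set vs = pverts G"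
    using finite_distinct_list pair_finite_verts by blast
  define n where "n = length vs"
  define A where "A = adjacency_mat G vs"
  have A: "A \<in> carrier_mat n n"
    unfolding A_def adjacency_mat_def n_def by simp
  have "A\<^sup>T = A"
    by (rule eq_matI)
      (auto simp: A_def adjacency_mat_def pair_graph_parcs(1)[OF G])
  moreover have "size {#x \<in># proots (char_poly A). x > 0#} \<le> 1"
    using pos adj_spectrum_eq[OF vs] unfolding A_def by simp
  ultimately obtain p where p: "p \<in> carrier_vec n"
    "\<And>c. c \<in> carrier_vec n \<Longrightarrow> p \<bullet> c = 0 \<Longrightarrow> c \<bullet> (A *\<^sub>v c) \<le> 0"
    using real_symmetric_one_pos[OF A] by blast
  have bij: "bij_betw ((!) vs) {0..<n} (pverts G)"
    using vs bij_betw_nth[of vs "{0..<n}" "pverts G"] unfolding n_def by (auto simp: atLeast0LessThan)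
  note reindex = sum.reindex_bij_betw[OF bij, symmetric]
  define q where "q a = p $ (the_inv_into {0..<n} ((!) vs) a)" for a
  have q: "q (vs ! i) = p $ i" if "i < n" for i
    unfolding q_def using that bij by (subst the_inv_into_f_f) (auto simp: bij_betw_def)
  show thesis
  proof (rule that)
    fix g :: "'a \<Rightarrow> real"
    assume g: "(\<Sum>a\<in>pverts G. q a * g a) = 0"
    define c where "c = vec n (\<lambda>i. g (vs ! i))"
    have "p \<bullet> c = (\<Sum>a\<in>pverts G. q a * g a)"
      unfolding reindex using q by (simp add: c_def scalar_prod_def)
    with g p(2)[of c] have "c \<bullet> (A *\<^sub>v c) \<le> 0"
      by (simp add: c_def)
    also have "c \<bullet> (A *\<^sub>v c)
        = (\<Sum>a\<in>pverts G. \<Sum>b\<in>pverts G. if (a, b) \<in> parcs G then g a * g b else 0)"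
      unfolding reindex
      by (auto simp: c_def scalar_prod_def A_def adjacency_mat_def n_def sum_distrib_left intro!: sum.cong)
    finally show "(\<Sum>a\<in>pverts G. \<Sum>b\<in>pverts G. if (a, b) \<in> parcs G then g a * g b else 0) \<le> 0" .
  qed
qed

text \<open>A plane meets the hyperplane given by \<open>q\<close> in a nonzero vector: one linear
  condition on the two coefficients always has a nontrivial solution. There the form is both
  positive and at most 0.\<close>

lemma nonadjacent_trans:
  fixes G :: "'a pair_pre_digraph"
  assumes G: "pair_graph G" and pos: "size {#x \<in># adj_spectrum G. x > 0#} \<le> 1"
    and ux: "(u, x) \<in> parcs G"
    and nonadj: "(u, v) \<notin> parcs G" "(u, w) \<notin> parcs G"
  shows "(v, w) \<notin> parcs G"
proof
  assume vw: "(v, w) \<in> parcs G"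
  interpret pair_graph G by fact
  obtain q :: "'a \<Rightarrow> real" where q: "\<And>g. (\<Sum>a\<in>pverts G. q a * g a) = 0 \<Longrightarrow>
     (\<Sum>a\<in>pverts G. \<Sum>b\<in>pverts G. if (a, b) \<in> parcs G then g a * g b else 0) \<le> 0"
    using adjacency_form_hyperplane[OF G pos] by blast
  note sym = pair_graph_parcs(1)[OF G] and irr = pair_graph_parcs(2)[OF G]
  \<comment> \<open>\<open>u\<close> adjacent to \<open>x\<close> but to neither \<open>v\<close>
    nor \<open>w\<close> separates \<open>x\<close> from these two; \<open>u\<close> equal to an end
    of the edge \<open>vw\<close> would be adjacent to the other end.\<close>
  have distinct: "distinct [u, v, w, x]"
    using ux vw nonadj sym irr by auto
  have neq: "u \<noteq> v" "v \<noteq> u" "u \<noteq> w" "w \<noteq> u" "u \<noteq> x" "x \<noteq> u" "v \<noteq> w" "w \<noteq> v" "v \<noteq> x" "x \<noteq> v"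
      "w \<noteq> x" "x \<noteq> w"
    using distinct by auto
  have sub: "{u, v, w, x} \<subseteq> pverts G"
    using pair_graph_parcs(3)[OF G ux] pair_graph_parcs(3)[OF G vw] by simp
  \<comment> \<open>The adjacency form is positive definite on the span of v + w and 2u + x.\<close>
  obtain \<alpha> \<beta> :: real where ab: "\<alpha> \<noteq> 0 \<or> \<beta> \<noteq> 0" "\<alpha> * (q v + q w) + \<beta> * (2 * q u + q x) = 0"
  proof (cases "q v + q w = 0")
    case True
    then show ?thesis using that[of 1 0] by simp
  next
    case False
    then show ?thesis using that[of "- (2 * q u + q x)" "q v + q w"] by (simp add: algebra_simps)
  qed
  \<comment> \<open>The weight 2 on \<open>u\<close> matters: with weight 1 and \<open>x\<close>
    adjacent to both \<open>v\<close> and \<open>w\<close> the form would only be 2 (a + b)^2 in the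
    two coefficients, which is not definite.\<close>
  define g where "g = (\<lambda>_. 0)(v := \<alpha>, w := \<alpha>, u := 2 * \<beta>, x := \<beta>)"
  define c :: real where
    "c = (if (x, v) \<in> parcs G then 1 else 0) + (if (x, w) \<in> parcs G then 1 else 0)"
  have g0: "g a = 0" if "a \<notin> {u, v, w, x}" for a
    using that by (simp add: g_def)
  have restrict: "(\<Sum>a\<in>pverts G. F a) = (\<Sum>a\<in>{u, v, w, x}. F a)"
    if "\<And>a. g a = 0 \<Longrightarrow> F a = 0" for F :: "'a \<Rightarrow> real"
    using sub that g0 pair_finite_verts by (intro sum.mono_neutral_right) auto
  have "(\<Sum>a\<in>pverts G. q a * g a) = 0"
    using neq ab(2) by (subst restrict) (auto simp: g_def algebra_simps)
  then have "(\<Sum>a\<in>pverts G. \<Sum>b\<in>pverts G. if (a, b) \<in> parcs G then g a * g b else 0) \<le> 0"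
    by (rule q)
  also have "(\<Sum>a\<in>pverts G. \<Sum>b\<in>pverts G. if (a, b) \<in> parcs G then g a * g b else 0)
      = (\<Sum>a\<in>pverts G. \<Sum>b\<in>{u, v, w, x}. if (a, b) \<in> parcs G then g a * g b else 0)"
    by (intro sum.cong refl restrict) auto
  also have "\<dots> = (\<Sum>a\<in>{u, v, w, x}. \<Sum>b\<in>{u, v, w, x}. if (a, b) \<in> parcs G then g a * g b else 0)"
    by (intro restrict sum.neutral) auto
  also have "\<dots> = 2 * \<alpha>\<^sup>2 + 4 * \<beta>\<^sup>2 + 2 * \<alpha> * \<beta> * c"
    using neq ux vw nonadj irr sym[of u x] sym[of v w] sym[of u v] sym[of u w] sym[of v x] sym[of w x]
    by (simp add: g_def c_def power2_eq_square algebra_simps)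
  also have "\<dots> = 2 * (\<alpha> + c / 2 * \<beta>)\<^sup>2 + (4 - c\<^sup>2 / 2) * \<beta>\<^sup>2"
    by (simp add: power2_eq_square field_simps)
  finally have le: "2 * (\<alpha> + c / 2 * \<beta>)\<^sup>2 + (4 - c\<^sup>2 / 2) * \<beta>\<^sup>2 \<le> 0" .
  have "2 * (\<alpha> + c / 2 * \<beta>)\<^sup>2 + (4 - c\<^sup>2 / 2) * \<beta>\<^sup>2 > 0"
  proof (cases "\<beta> = 0")
    case True
    then show ?thesis
      using ab(1) by simp
  next
    case False
    have "c\<^sup>2 \<le> 4"
      by (simp add: c_def)
    with False show ?thesis
      by (intro add_nonneg_pos mult_pos_pos) auto
  qed
  with le show False
    by linarith
qed

lemma multipartition_exists:
  fixes G :: "'a pair_pre_digraph"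
  assumes G: "pair_graph G" and no_isolated: "\<forall>v \<in> pverts G. \<exists>w. (v, w) \<in> parcs G"
    and pos: "size {#x \<in># adj_spectrum G. x > 0#} \<le> 1"
  shows "\<exists>cs. multipartition G cs"
proof -
  interpret pair_graph G by fact
  define R where "R = {(u, v). u \<in> pverts G \<and> v \<in> pverts G \<and> (u, v) \<notin> parcs G}"
  note sym = pair_graph_parcs(1)[OF G] and irr = pair_graph_parcs(2)[OF G]
  have R: "equiv (pverts G) R"
  proof (rule equivI)
    show "refl_on (pverts G) R"
      using irr by (auto simp: refl_on_def R_def)
    show "Relation.sym R"
      using sym by (auto simp: R_def intro!: symI)
    show "trans R"
    proof (rule transI)
      fix a b c assume "(a, b) \<in> R" "(b, c) \<in> R"
      \<comment> \<open>The middle vertex \<open>b\<close> plays the role of \<open>u\<close>; its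
        neighbour exists because no vertex is isolated.\<close>
      then show "(a, c) \<in> R"
        using nonadjacent_trans[OF G pos, of b _ a c] no_isolated sym unfolding R_def by blast
    qed
  qed (auto simp: R_def)
  have "finite (pverts G // R)"
    using pair_finite_verts by (rule finite_quotient) (auto simp: R_def)
  then obtain cs where cs: "distinct cs" "set cs = pverts G // R"
    using finite_distinct_list by blast
  have "parcs G = {(u, v). u \<in> pverts G \<and> v \<in> pverts G \<and> (\<forall>X\<in>set cs. u \<in> X \<longrightarrow> v \<notin> X)}"
  proof -
    have iff: "(\<forall>X\<in>pverts G // R. u \<in> X \<longrightarrow> v \<notin> X) \<longleftrightarrow> (u, v) \<notin> R" if "u \<in> pverts G" for u v
      using in_quotient_imp_closed[OF R] quotientI[OF that] equiv_class_self[OF R that]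
        quotient_eqI[OF R] in_quotient_imp_in_rel[OF R] by (metis Image_singleton_iff insert_subset empty_subsetI)
    have "(u, v) \<in> parcs G
        \<longleftrightarrow> u \<in> pverts G \<and> v \<in> pverts G \<and> (\<forall>X\<in>pverts G // R. u \<in> X \<longrightarrow> v \<notin> X)" for u v
    proof -
      have "(u, v) \<in> R \<longleftrightarrow> u \<in> pverts G \<and> v \<in> pverts G \<and> (u, v) \<notin> parcs G"
        by (simp add: R_def)
      then show ?thesis
        using iff[of u v] pair_graph_parcs(3)[OF G, of u v] by auto
    qed
    then show ?thesis
      unfolding cs(2) by auto
  qed
  moreover have "pairwise disjnt (set cs)"
    unfolding cs(2) pairwise_def disjnt_def using quotient_disj[OF R] by blast
  moreover have "{} \<notin> set cs"
    unfolding cs(2) using in_quotient_imp_non_empty[OF R] by blast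
  ultimately have "multipartition G cs"
    unfolding multipartition_def using cs Union_quotient[OF R] by simp
  then show ?thesis ..
qed

section \<open>Characteristic polynomial and spectrum of a complete multipartite graph\<close>

lemma poly_eqI_pos:
  fixes p q :: "real poly"
  assumes "\<And>x. x > 0 \<Longrightarrow> poly p x = poly q x"
  shows "p = q"
proof (rule ccontr)
  assume "p \<noteq> q"
  then have "finite {x. poly (p - q) x = 0}"
    by (intro poly_roots_finite) simp
  moreover have "{0<..} \<subseteq> {x. poly (p - q) x = 0}"
    using assms by auto
  ultimately show False
    using finite_subset infinite_Ioi by blast
qed

text \<open>The adjacency matrix factors through the k classes, so Sylvester's identity leaves a k
  by k determinant, a diagonal matrix minus one of rank one. The power of x on the left avoids a
  difference of exponents.\<close>

lemma char_poly_multipartition: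
  assumes mp: "multipartition G cs" and vs: "distinct vs" "set vs = pverts G"
  shows "char_poly (adjacency_mat G vs) * [:0, 1:] ^ length cs
    = [:0, 1:] ^ length vs * mp_poly (map card cs)"
proof (rule poly_eqI_pos)
  fix x :: real assume x: "x > 0"
  define n k where "n = length vs" "k = length cs"
  define A where "A = adjacency_mat G vs"
  have A: "A \<in> carrier_mat n n"
    unfolding A_def adjacency_mat_def n_k_def by simp
  have fin: "finite X" if "X \<in> set cs" for X
    using mp that vs(2) unfolding multipartition_def by (metis List.finite_set Union_upper finite_subset)
  have disj: "v \<in> cs ! a \<Longrightarrow> v \<in> cs ! b \<Longrightarrow> a = b" if "a < k" "b < k" for v a b
  proof -
    assume "v \<in> cs ! a" "v \<in> cs ! b"
    then have "\<not> disjnt (cs ! a) (cs ! b)"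
      unfolding disjnt_def by blast
    then have "cs ! a = cs ! b"
      using mp that unfolding multipartition_def pairwise_def n_k_def by (metis nth_mem)
    then show "a = b"
      using mp that unfolding multipartition_def n_k_def by (metis nth_eq_iff_index_eq)
  qed
  have vs_class: "vs ! i \<in> pverts G \<and> (\<exists>a<k. vs ! i \<in> cs ! a)" if "i < n" for i
  proof -
    have "vs ! i \<in> pverts G"
      using that vs(2) unfolding n_k_def by (metis nth_mem)
    moreover then have "vs ! i \<in> \<Union> (set cs)"
      using mp unfolding multipartition_def by metis
    ultimately show ?thesis
      unfolding n_k_def by (metis UnionE in_set_conv_nth)
  qed
  \<comment> \<open>Row i of \<open>S\<close> marks the class of vertex i, scaled by 1/x; column j
    of \<open>V\<close> marks the classes that do not contain vertex j. Their product is therefore A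
    / x.\<close>
  define S where "S = mat n k (\<lambda>(i, a). if vs ! i \<in> cs ! a then 1 / x else 0)"
  define V where "V = mat k n (\<lambda>(a, i). if vs ! i \<in> cs ! a then 0 else 1 :: real)"
  have SV: "- (char_matrix A x) = x \<cdot>\<^sub>m (1\<^sub>m n - S * V)"
  proof (rule eq_matI)
    fix i j assume "i < dim_row (x \<cdot>\<^sub>m (1\<^sub>m n - S * V))" "j < dim_col (x \<cdot>\<^sub>m (1\<^sub>m n - S * V))"
    then have ij: "i < n" "j < n"
      by (auto simp: S_def V_def)
    obtain a where a: "a < k" "vs ! i \<in> cs ! a"
      using vs_class[OF ij(1)] by blast
    have arc: "(vs ! i, vs ! j) \<in> parcs G \<longleftrightarrow> vs ! j \<notin> cs ! a"
    proof -
      have "(\<forall>X\<in>set cs. vs ! i \<in> X \<longrightarrow> vs ! j \<notin> X) \<longleftrightarrow> vs ! j \<notin> cs ! a"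
        using a disj unfolding n_k_def by (metis in_set_conv_nth)
      then show ?thesis
        using mp vs_class[OF ij(1)] vs_class[OF ij(2)] unfolding multipartition_def by auto
    qed
    have "(S * V) $$ (i, j)
        = (\<Sum>b = 0..<k. (if vs ! i \<in> cs ! b then 1 / x else 0) * (if vs ! j \<in> cs ! b then 0 else 1))"
      using ij by (simp add: S_def V_def scalar_prod_def)
    also have "\<dots> = (\<Sum>b = 0..<k. if a = b then 1 / x * (if vs ! j \<in> cs ! a then 0 else 1) else 0)"
      using a disj[OF a(1)] by (intro sum.cong) auto
    also have "\<dots> = 1 / x * (if (vs ! i, vs ! j) \<in> parcs G then 1 else 0)"
      using a arc by simp
    finally have "(S * V) $$ (i, j) = 1 / x * A $$ (i, j)"
      using ij unfolding A_def adjacency_mat_def n_k_def by simp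
    moreover have "(x \<cdot>\<^sub>m (1\<^sub>m n - S * V)) $$ (i, j) = x * (1\<^sub>m n $$ (i, j) - (S * V) $$ (i, j))"
      using ij by (simp add: S_def V_def)
    ultimately show "(- (char_matrix A x)) $$ (i, j) = (x \<cdot>\<^sub>m (1\<^sub>m n - S * V)) $$ (i, j)"
      using ij A x by (simp add: char_matrix_def right_diff_distrib)
  qed (use A in \<open>auto simp: char_matrix_def S_def V_def\<close>)
  let ?c = "\<lambda>a. real (card (cs ! a))"
  \<comment> \<open>Off the diagonal \<open>V * S\<close> has the entries n_b / x, on it 0. Adding
    n_a / x to the diagonal entry of the first part makes the second part a full rank-one
    matrix.\<close>
  have VS: "1\<^sub>m k - V * S = mat k k (\<lambda>(a, b). (if a = b then 1 + ?c a / x else 0) - 1 * (?c b / x))"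
  proof (rule eq_matI, goal_cases)
    case (1 a b)
    then have ab: "a < k" "b < k" by auto
    have card: "(\<Sum>j = 0..<n. if vs ! j \<in> cs ! b then 1 else 0) = ?c b"
    proof -
      have "bij_betw ((!) vs) {0..<n} (set vs)"
        using vs(1) unfolding n_k_def by (intro bij_betw_nth) auto
      then have "(\<Sum>j = 0..<n. if vs ! j \<in> cs ! b then 1 else (0 :: real))
          = (\<Sum>v\<in>set vs. if v \<in> cs ! b then 1 else 0)"
        by (rule sum.reindex_bij_betw)
      also have "\<dots> = real (card (set vs \<inter> cs ! b))"
        by (simp flip: sum.inter_restrict)
      also have "set vs \<inter> cs ! b = cs ! b"
        using mp ab unfolding vs(2) multipartition_def n_k_def by (metis Int_absorb1 Union_upper nth_mem)
      finally show ?thesis .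
    qed
    have "(V * S) $$ (a, b) = (\<Sum>j = 0..<n. (if vs ! j \<in> cs ! a then 0 else 1) * (if vs ! j \<in> cs ! b then 1 / x else 0))"
      using ab by (simp add: S_def V_def scalar_prod_def)
    also have "\<dots> = (\<Sum>j = 0..<n. (if a = b then 0 else 1 / x) * (if vs ! j \<in> cs ! b then 1 else 0))"
      using disj[OF ab] by (intro sum.cong) auto
    also have "\<dots> = (if a = b then 0 else 1 / x) * ?c b"
      unfolding sum_distrib_left[symmetric] card ..
    finally show ?case
      using ab by (simp add: S_def V_def)
  qed (auto simp: S_def V_def)
  have pos: "1 + ?c a / x > 0" for a
    using x by (intro add_pos_nonneg) auto
  have "poly (char_poly A) x = x ^ n * det (1\<^sub>m n - S * V)"
    unfolding char_poly_matrix[OF A] SV by (simp add: S_def V_def)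
  also have "det (1\<^sub>m n - S * V) = det (1\<^sub>m k - V * S)"
    by (rule det_one_minus_mult_commute) (auto simp: S_def V_def)
  also have "\<dots> = (\<Prod>a<k. 1 + ?c a / x) * (1 - (\<Sum>a<k. ?c a / x * 1 / (1 + ?c a / x)))"
    unfolding VS using pos by (intro det_diagonal_minus_rank_one) (metis less_numeral_extra(3))
  also have "(\<Sum>a<k. ?c a / x * 1 / (1 + ?c a / x)) = (\<Sum>a<k. ?c a / (x + ?c a))"
    using x by (intro sum.cong refl) (simp add: field_simps)
  also have "\<dots> = (\<Sum>m\<leftarrow>map card cs. real m / (x + real m))"
    unfolding n_k_def by (simp add: sum_list_sum_nth atLeast0LessThan)
  also have "(\<Prod>a<k. 1 + ?c a / x) = poly (class_prod (map card cs)) x / x ^ k"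
  proof -
    have "poly (class_prod (map card cs)) x = (\<Prod>a<k. x + ?c a)"
      unfolding class_prod_def n_k_def poly_prod_list
      by (simp add: prod.list_conv_set_nth atLeast0LessThan comp_def add.commute)
    moreover have "(\<Prod>a<k. x + ?c a) = (\<Prod>a<k. x * (1 + ?c a / x))"
      using x by (intro prod.cong) (auto simp: field_simps)
    ultimately show ?thesis
      using x by (simp add: prod.distrib)
  qed
  finally have "poly (char_poly A) x * x ^ k = x ^ n * poly (mp_poly (map card cs)) x"
    unfolding poly_mp_poly[OF x] using x by simp
  then show "poly (char_poly (adjacency_mat G vs) * [:0, 1:] ^ length cs) x
      = poly ([:0, 1:] ^ length vs * mp_poly (map card cs)) x"
    by (simp add: A_def n_k_def)
qed

lemma multipartition_size:
  assumes mp: "multipartition G cs" and fin: "finite (pverts G)"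
  shows "card (pverts G) = sum_list (map card cs)" "0 \<notin> set (map card cs)"
    "length cs \<le> card (pverts G)"
proof -
  have fin_class: "finite X" if "X \<in> set cs" for X
    using mp that fin unfolding multipartition_def by (metis Union_upper finite_subset)
  have "card (\<Union> (set cs)) = sum card (set cs)"
    using mp fin_class unfolding multipartition_def by (intro card_Union_disjoint) auto
  then show eq: "card (pverts G) = sum_list (map card cs)"
    using mp unfolding multipartition_def by (simp add: sum_list_distinct_conv_sum_set)
  show nz: "0 \<notin> set (map card cs)"
    using mp fin_class unfolding multipartition_def by auto
  have "length ns \<le> sum_list ns" if "0 \<notin> set ns" for ns :: "nat list"
    using that by (induction ns) auto
  from this[OF nz] show "length cs \<le> card (pverts G)"
    unfolding eq by simp
qed

text \<open>By this no root of \<open>mp_poly\<close> counts as an eigenvalue 0, so all but two of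
  its roots will have to be -2.\<close>

lemma mp_poly_at_0:
  assumes "0 \<notin> set ns" "length ns \<ge> 2"
  shows "poly (mp_poly ns) 0 \<noteq> 0"
  using assms unfolding poly_mp_poly_0 by (auto simp: prod_list_zero_iff)

lemma adj_spectrum_multipartition:
  assumes mp: "multipartition G cs" and fin: "finite (pverts G)" and k: "length cs \<ge> 2"
  shows "adj_spectrum G
    = replicate_mset (sum_list (map card cs) - length cs) 0 + proots (mp_poly (map card cs))"
proof -
  obtain vs where vs: "distinct vs" "set vs = pverts G"
    using finite_distinct_list fin by blast
  define n where "n = card (pverts G)"
  have n: "length vs = n"
    using vs unfolding n_def by (metis distinct_card)
  note size = multipartition_size[OF mp fin]
  have q0: "mp_poly (map card cs) \<noteq> 0"
    using mp_poly_at_0[OF size(2)] k by auto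
  \<comment> \<open>The truncated difference of exponents is exact, as there are at most as many
    classes as vertices.\<close>
  have "char_poly (adjacency_mat G vs) * [:0, 1:] ^ length cs
      = [:0, 1:] ^ (n - length cs) * mp_poly (map card cs) * [:0, 1:] ^ length cs"
    using char_poly_multipartition[OF mp vs] size(3) unfolding n n_def
    by (simp add: ac_simps flip: power_add)
  then have "char_poly (adjacency_mat G vs) = [:0, 1:] ^ (n - length cs) * mp_poly (map card cs)"
    by (subst (asm) mult_cancel_right) auto
  moreover have "repeat_mset m {#0#} = replicate_mset m (0 :: real)" for m
    by (induction m) auto
  ultimately show ?thesis
    using adj_spectrum_eq[OF vs] q0 size(1)
    by (simp add: proots_mult proots_power n_def)
qed

text \<open>Diagonalizability over the reals means that no root of the characteristic polynomial is
  lost. Hence \<open>mp_poly\<close> has as many real roots, with multiplicity, as there are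
  classes.\<close>

lemma size_adj_spectrum:
  assumes "pair_graph G"
  shows "size (adj_spectrum G) = card (pverts G)"
proof -
  interpret pair_graph G by fact
  obtain vs where vs: "distinct vs" "set vs = pverts G"
    using finite_distinct_list pair_finite_verts by blast
  have A: "adjacency_mat G vs \<in> carrier_mat (length vs) (length vs)"
    unfolding adjacency_mat_def by simp
  have "(adjacency_mat G vs)\<^sup>T = adjacency_mat G vs"
    by (rule eq_matI) (auto simp: adjacency_mat_def pair_graph_parcs(1)[OF assms])
  then obtain D where "proots (char_poly (adjacency_mat G vs)) = {#D $$ (i, i). i \<in># mset_set {..<length vs}#}"
    using real_symmetric_proots[OF A] by metis
  then show ?thesis
    using adj_spectrum_eq[OF vs] vs by (simp add: distinct_card[symmetric])
qed

section \<open>Classification\<close>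

lemma size_count_split: "size M = count M a + size {#x \<in># M. x \<noteq> a#}"
proof -
  have "size M = size {#x \<in># M. x = a#} + size {#x \<in># M. x \<noteq> a#}"
    by (metis multiset_partition size_union)
  then show ?thesis
    by (simp add: count_conv_size_mset)
qed

text \<open>Sorting the classes of size different from 2 gives the triple 1, 1, 3 in this order.\<close>

lemma multipartition_class_sizes:
  assumes mp: "multipartition G cs"
  obtains ds t ms where "multipartition G ds" "map card ds = replicate t 2 @ ms" "2 \<notin> set ms" "sorted ms"
proof
  let ?es = "sort_key card cs"
  define ds where "ds = filter (\<lambda>X. card X = 2) ?es @ filter (\<lambda>X. card X \<noteq> 2) ?es"
  show "multipartition G ds"
    using mp by (rule multipartition_cong) (use mp in \<open>auto simp: ds_def multipartition_def\<close>)
  show "map card ds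
      = replicate (length (filter (\<lambda>X. card X = 2) ?es)) 2 @ map card (filter (\<lambda>X. card X \<noteq> 2) ?es)"
    unfolding ds_def map_append by (subst map_replicate_const[symmetric]) (auto intro!: map_cong)
  show "2 \<notin> set (map card (filter (\<lambda>X. card X \<noteq> 2) ?es))"
    by auto
  show "sorted (map card (filter (\<lambda>X. card X \<noteq> 2) ?es))"
    by (rule sorted_filter) simp
qed

section \<open>Isomorphism type and spectrum in each of the three families\<close>

lemma bipartite_case:
  assumes G: "pair_graph G" and mp: "multipartition G cs" and cs: "map card cs = [a, b]" "b \<le> a"
  shows "\<exists>l m :: nat. l \<ge> m \<and> m \<ge> 1
    \<and> digraph_iso (with_proj G) (with_proj (complete_multipartite [l, m]))
    \<and> adj_spectrum G = replicate_mset (l + m - 2) 0 + {# sqrt (real l * real m), - sqrt (real l * real m) #}"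
proof (rule exI[of _ a], rule exI[of _ b], intro conjI)
  interpret pair_graph G by fact
  have len: "length cs = 2"
    using arg_cong[OF cs(1), of length] by simp
  show "b \<ge> 1"
    using multipartition_size(2)[OF mp pair_finite_verts] unfolding cs by simp
  show "digraph_iso (with_proj G) (with_proj (complete_multipartite [a, b]))"
    using multipartition_digraph_iso[OF G mp] unfolding cs .
  have "proots (mp_poly [a, b]) = {# sqrt (real a * real b), - sqrt (real a * real b) #}"
    unfolding mp_poly_pair by (subst proots_mult) (simp_all del: mult_pCons_left mult_pCons_right)
  then show "adj_spectrum G
      = replicate_mset (a + b - 2) 0 + {# sqrt (real a * real b), - sqrt (real a * real b) #}"
    using adj_spectrum_multipartition[OF mp pair_finite_verts] unfolding cs len by simp
qed (fact cs)

lemma all_but_one_2_case: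
  assumes G: "pair_graph G" and mp: "multipartition G cs"
    and cs: "map card cs = replicate (k - 1) 2 @ [m]" and k: "k \<ge> 3"
  defines "s \<equiv> sqrt ((real k)\<^sup>2 + 2 * (real k - 1) * (real m - 2))"
  shows "m \<ge> 1 \<and> digraph_iso (with_proj G) (with_proj (complete_multipartite (replicate (k - 1) 2 @ [m])))
    \<and> adj_spectrum G = replicate_mset (k - 2) (- 2) + replicate_mset (k + m - 2) 0
        + {# real k - 2 + s, real k - 2 - s #}"
proof (intro conjI)
  interpret pair_graph G by fact
  have len: "length cs = k"
    using arg_cong[OF cs, of length] k by simp
  have sum: "sum_list (map card cs) - k = k + m - 2"
    unfolding cs using k by (simp add: sum_list_replicate)
  show "m \<ge> 1"
    using multipartition_size(2)[OF mp pair_finite_verts] unfolding cs by simp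
  show "digraph_iso (with_proj G) (with_proj (complete_multipartite (replicate (k - 1) 2 @ [m])))"
    using multipartition_digraph_iso[OF G mp] unfolding cs .
  have rep: "repeat_mset j {#- 2#} = replicate_mset j (- 2 :: real)" for j
    by (induction j) auto
  have "proots (mp_poly (map card cs)) = replicate_mset (k - 2) (- 2) + {# real k - 2 + s, real k - 2 - s #}"
    unfolding cs s_def using k
    by (subst mp_poly_all_but_one_2)
      (simp_all add: proots_mult proots_power rep del: mult_pCons_left mult_pCons_right)
  then show "adj_spectrum G = replicate_mset (k - 2) (- 2) + replicate_mset (k + m - 2) 0
        + {# real k - 2 + s, real k - 2 - s #}"
    using adj_spectrum_multipartition[OF mp pair_finite_verts] k unfolding len sum by simp
qed

lemma case_113:
  assumes G: "pair_graph G" and mp: "multipartition G cs" and cs: "map card cs = [1, 1, 3]"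
  shows "digraph_iso (with_proj G) (with_proj (complete_multipartite [1, 1, 3]))
    \<and> adj_spectrum G = {# - 2, - 1, 0, 0, 3 #}"
proof
  interpret pair_graph G by fact
  have len: "length cs = 3"
    using arg_cong[OF cs, of length] by simp
  show "digraph_iso (with_proj G) (with_proj (complete_multipartite [1, 1, 3]))"
    using multipartition_digraph_iso[OF G mp] unfolding cs .
  have "proots (mp_poly [1, 1, 3]) = {# - 2, - 1, 3 #}"
    unfolding mp_poly_113 by (simp add: proots_mult del: mult_pCons_left mult_pCons_right)
  moreover have "replicate_mset 2 0 = {#0, 0 :: real#}"
    by (simp add: numeral_2_eq_2)
  ultimately show "adj_spectrum G = {# - 2, - 1, 0, 0, 3 #}"
    using adj_spectrum_multipartition[OF mp pair_finite_verts] unfolding cs len by simp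
qed

theorem theorem2:
  fixes G :: "'a pair_pre_digraph"
  assumes simple: "pair_graph G"
    and no_isolated: "\<forall>v \<in> pverts G. \<exists>w. (v, w) \<in> parcs G"
    and few: "size {# x \<in># adj_spectrum G. x \<noteq> - 2 \<and> x \<noteq> 0 #} \<le> 2"
    and one_pos: "size {# x \<in># adj_spectrum G. x > 0 #} = 1"
  shows
    "(\<exists>l m :: nat. l \<ge> m \<and> m \<ge> 1
        \<and> digraph_iso (with_proj G) (with_proj (complete_multipartite [l, m]))
        \<and> adj_spectrum G = replicate_mset (l + m - 2) 0
            + {# sqrt (real l * real m), - sqrt (real l * real m) #})
     \<or> (digraph_iso (with_proj G) (with_proj (complete_multipartite [1, 1, 3]))
        \<and> adj_spectrum G = {# - 2, - 1, 0, 0, 3 #})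
     \<or> (\<exists>k m :: nat. k \<ge> 3 \<and> m \<ge> 1
        \<and> digraph_iso (with_proj G) (with_proj (complete_multipartite (replicate (k - 1) 2 @ [m])))
        \<and> adj_spectrum G = replicate_mset (k - 2) (- 2) + replicate_mset (k + m - 2) 0
            + {# real k - 2 + sqrt ((real k)\<^sup>2 + 2 * (real k - 1) * (real m - 2)),
                 real k - 2 - sqrt ((real k)\<^sup>2 + 2 * (real k - 1) * (real m - 2)) #})"
proof -
  interpret pair_graph G by fact
  note fin = pair_finite_verts
  obtain cs0 where "multipartition G cs0"
    using multipartition_exists[OF simple no_isolated] one_pos by auto
  then obtain cs t ms where mp: "multipartition G cs" and sizes: "map card cs = replicate t 2 @ ms"
      and ms: "2 \<notin> set ms" "sorted ms"
    by (rule multipartition_class_sizes)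
  define k where "k = length cs"
  note nz = multipartition_size(2)[OF mp fin]
  have k_eq: "k = t + length ms"
    using arg_cong[OF sizes, of length] by (simp add: k_def)
  \<comment> \<open>A positive eigenvalue requires a vertex, hence an edge, and its ends lie in
    different classes.\<close>
  have k2: "k \<ge> 2"
  proof -
    have "adj_spectrum G \<noteq> {#}"
      using one_pos by auto
    then have "pverts G \<noteq> {}"
      using size_adj_spectrum[OF simple] fin by (metis card.empty size_eq_0_iff_empty)
    then obtain v w where vw: "(v, w) \<in> parcs G"
      using no_isolated by blast
    then have "v \<in> \<Union> (set cs)" "w \<in> \<Union> (set cs)" "\<forall>X\<in>set cs. v \<in> X \<longrightarrow> w \<notin> X"
      using mp unfolding multipartition_def by auto
    then obtain X Y where "{X, Y} \<subseteq> set cs" "X \<noteq> Y"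
      by blast
    then have "2 \<le> card (set cs)"
      by (metis card_2_iff card_mono List.finite_set)
    then show ?thesis
      unfolding k_def using card_length le_trans by blast
  qed
  define M where "M = proots (mp_poly (map card cs))"
  have spec: "adj_spectrum G = replicate_mset (card (pverts G) - k) 0 + M"
    using adj_spectrum_multipartition[OF mp fin] k2 multipartition_size(1)[OF mp fin]
    unfolding k_def M_def by simp
  have "size M = k"
    using size_adj_spectrum[OF simple] multipartition_size(3)[OF mp fin] unfolding spec k_def by simp
  moreover have "size {#x \<in># M. x \<noteq> - 2#} \<le> 2"
  proof -
    have "0 \<notin># M"
      using mp_poly_at_0[OF nz] k2 unfolding M_def k_def by (cases "mp_poly (map card cs) = 0") auto
    then have "{#x \<in># M. x \<noteq> - 2 \<and> x \<noteq> 0#} = {#x \<in># M. x \<noteq> - 2#}"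
      by (intro filter_mset_cong) auto
    moreover have "{#x \<in># replicate_mset j 0. x \<noteq> - 2 \<and> x \<noteq> 0#} = ({#} :: real multiset)" for j
      by (induction j) auto
    ultimately have "{#x \<in># adj_spectrum G. x \<noteq> - 2 \<and> x \<noteq> 0#} = {#x \<in># M. x \<noteq> - 2#}"
      unfolding spec by simp
    then show ?thesis
      using few by simp
  qed
  \<comment> \<open>Of the k roots at most two differ from -2.\<close>
  ultimately have mult: "order (- 2) (mp_poly (map card cs)) \<ge> k - 2"
    using size_count_split[of M "- 2"] mp_poly_at_0[OF nz] k2 unfolding M_def k_def
    by (cases "mp_poly (map card cs) = 0") auto
  consider "k = 2" | "k \<ge> 3" "t = 0" | "k \<ge> 3" "t > 0"
    using k2 by linarith
  then show ?thesis
  proof cases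
    case 1
    then have "length (map card cs) = 2"
      by (simp add: k_def)
    then obtain a b where ab: "map card cs = [a, b]"
      by (auto simp: numeral_2_eq_2 length_Suc_conv)
    show ?thesis
    proof (cases "b \<le> a")
      case True
      then show ?thesis
        using bipartite_case[OF simple mp ab] by blast
    next
      case False
      \<comment> \<open>The arrangement of the classes puts size 2 first and the others in
        increasing order, so the larger class may come second.\<close>
      have "multipartition G (rev cs)"
        using mp by (rule multipartition_cong) (use mp in \<open>auto simp: multipartition_def\<close>)
      moreover have "map card (rev cs) = [b, a]"
        using ab by (simp add: rev_map[symmetric])
      ultimately show ?thesis
        using bipartite_case[OF simple, of "rev cs" b a] False by fastforce
    qed
  next
    case 2
    have "order (- 2) (mp_poly ms) \<le> 1"
      using nz ms 2 sizes by (intro order_mp_poly_le_1) auto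
    \<comment> \<open>k - 2 <= 1 together with k >= 3 leaves k = 3, and then the multiplicity is at
      least 1, so -2 is a root.\<close>
    with mult have "k = 3" "order (- 2) (mp_poly ms) \<noteq> 0"
      using 2 sizes by auto
    moreover from \<open>k = 3\<close> obtain a b c where abc: "ms = [a, b, c]"
      using k_eq 2 by (auto simp: numeral_3_eq_3 length_Suc_conv)
    ultimately have "a = 1 \<and> b = 1 \<and> c = 3"
      using order_root[of "mp_poly ms" "- 2"] ms nz sizes 2 by (intro three_classes_root_minus_2) auto
    then show ?thesis
      using case_113[OF simple mp] sizes abc 2 by simp
  next
    case 3
    then obtain t' where t': "t = Suc t'"
      by (cases t) auto
    have "order (- 2) (mp_poly (map card cs)) = t'"
      unfolding sizes t' using order_mp_poly_replicate[of 2 ms t'] ms by simp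
    \<comment> \<open>The multiplicity t - 1 is at least k - 2 = t + \<open>length ms\<close> -
      2.\<close>
    with mult k_eq t' have "length ms \<le> 1"
      by simp
    then have "\<exists>m. map card cs = replicate (k - 1) 2 @ [m]"
    proof (cases ms)
      case Nil
      then show ?thesis
        \<comment> \<open>If all classes have size 2, one of them takes the place of the exceptional
          class, with m = 2.\<close>
        using sizes k_eq t' by (intro exI[of _ 2]) (simp add: replicate_append_same)
    next
      case (Cons m ms')
      then show ?thesis
        using sizes k_eq \<open>length ms \<le> 1\<close> by simp
    qed
    then show ?thesis
      using all_but_one_2_case[OF simple mp] 3 by blast
  qed
qed

end
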